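(* The radii of the classes $\mathcal{G}_1,\mathcal{G}_2,\mathcal{G}_3$ with respect to the class $\mathcal{S}_{sin}^*$ (starlike functions associated with the sine function) are exactly: (i) $R_{\mathcal{S}_{sin}^{*}}(\mathcal{G}_1)= \dfrac{\sin 1}{3+\sqrt{9+\sin^2 1}}\approx 0.1375$; (ii) $R_{\mathcal{S}_{sin}^{*}}(\mathcal{G}_2)= \dfrac{2\sin 1}{5+\sqrt{25+4\sin 1+4\sin^2 1}}\approx 0.1589$; (iii) $R_{\mathcal{S}_{sin}^{*}}(\mathcal{G}_3)= \dfrac{\sin 1}{2+\sqrt{4+\sin^2 1}}\approx 0.2018$.
   Context: $\mathbb{D}$ is the open unit disc in $\mathbb{C}$. $\mathcal{A}$ is the class of analytic functions $f$ on $\mathbb{D}$ with $f(0)=0$, $f'(0)=1$. $\mathcal{P}$ is the class of analytic functions $p$ on $\mathbb{D}$ with $p(0)=1$ and $\operatorname{Re}p(z)>0$ for all $z\in\mathbb{D}$; $\mathcal{P}(1/2)=\{p\in\mathcal{P}:\operatorname{Re}p(z)>1/2 \text{ for all } z\in\mathbb{D}\}$. Quotients below are understood with removable singularities filled in (in particular at $0$). Define $\mathcal{G}_1=\{f\in\mathcal{A}: f/g\in\mathcal{P}\text{ and } g/(zp)\in\mathcal{P}\text{ for some } g\in\mathcal{A},\ p\in\mathcal{P}\}$, $\mathcal{G}_2=\{f\in\mathcal{A}: f/g\in\mathcal{P}\text{ and } g/(zp)\in\mathcal{P}(1/2)\text{ for some } g\in\mathcal{A},\ p\in\mathcal{P}\}$,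 $\mathcal{G}_3=\{f\in\mathcal{A}: f/(zp)\in\mathcal{P}\text{ for some } p\in\mathcal{P}\}$. For subclasses $\mathcal{F},\mathcal{G}$ of $\mathcal{A}$, the $\mathcal{G}$-radius $R_{\mathcal{G}}(\mathcal{F})$ of $\mathcal{F}$ is the largest number $R\in(0,1)$ such that, for every $f\in\mathcal{F}$ and every $0<r<R$, the function $z\mapsto r^{-1}f(rz)$ belongs to $\mathcal{G}$. For analytic $f,g$ on $\mathbb{D}$, $f\prec g$ ($f$ is subordinate to $g$) means $f=g\circ w$ for some analytic $w:\mathbb{D}\to\mathbb{D}$ with $w(0)=0$. $\mathcal{S}_{sin}^*=\{f\in\mathcal{A}: zf'(z)/f(z)\prec 1+\sin z\}$. *)

theory Defs
  imports "HOL-Complex_Analysis.Complex_Analysis"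
begin

text \<open>
  Functions on the unit disc are total functions \<open>complex \<Rightarrow> complex\<close> whose values off
  the disc are irrelevant to all the notions below. Quotients are passed through
  \<^const>\<open>remove_sings\<close>, which fills in removable singularities; at a pole it returns a junk value,
  but then the result is not continuous there, so it lies in none of the classes below.
\<close>

abbreviation unit_disc :: "complex set" where
  "unit_disc \<equiv> ball 0 1"

definition class_A :: "(complex \<Rightarrow> complex) set" where
  "class_A = {f. f analytic_on unit_disc \<and> f 0 = 0 \<and> deriv f 0 = 1}"

definition class_P :: "(complex \<Rightarrow> complex) set" where
  "class_P = {p. p analytic_on unit_disc \<and> p 0 = 1 \<and> (\<forall>z\<in>unit_disc. Re (p z) > 0)}"

definition class_P_half :: "(complex \<Rightarrow> complex) set" where
  "class_P_half = {p \<in> class_P. \<forall>z\<in>unit_disc. Re (p z) > 1 / 2}"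

definition class_G1 :: "(complex \<Rightarrow> complex) set" where
  "class_G1 = {f \<in> class_A. \<exists>g\<in>class_A. \<exists>p\<in>class_P.
     remove_sings (\<lambda>z. f z / g z) \<in> class_P \<and>
     remove_sings (\<lambda>z. g z / (z * p z)) \<in> class_P}"

definition class_G2 :: "(complex \<Rightarrow> complex) set" where
  "class_G2 = {f \<in> class_A. \<exists>g\<in>class_A. \<exists>p\<in>class_P.
     remove_sings (\<lambda>z. f z / g z) \<in> class_P \<and>
     remove_sings (\<lambda>z. g z / (z * p z)) \<in> class_P_half}"

definition class_G3 :: "(complex \<Rightarrow> complex) set" where
  "class_G3 = {f \<in> class_A. \<exists>p\<in>class_P. remove_sings (\<lambda>z. f z / (z * p z)) \<in> class_P}"

definition subordinate :: "(complex \<Rightarrow> complex) \<Rightarrow> (complex \<Rightarrow> complex) \<Rightarrow> bool"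
    (infix "\<prec>\<^sub>s" 50) where
  "f \<prec>\<^sub>s g \<longleftrightarrow> f analytic_on unit_disc \<and> g analytic_on unit_disc \<and>
     (\<exists>w. w analytic_on unit_disc \<and> w ` unit_disc \<subseteq> unit_disc \<and> w 0 = 0 \<and>
          (\<forall>z\<in>unit_disc. f z = g (w z)))"

definition class_S_sin :: "(complex \<Rightarrow> complex) set" where
  "class_S_sin = {f \<in> class_A. remove_sings (\<lambda>z. z * deriv f z / f z) \<prec>\<^sub>s (\<lambda>z. 1 + sin z)}"

definition radius_admissible ::
    "(complex \<Rightarrow> complex) set \<Rightarrow> (complex \<Rightarrow> complex) set \<Rightarrow> real \<Rightarrow> bool" where
  "radius_admissible G F R \<longleftrightarrow> 0 < R \<and> R < 1 \<and>
     (\<forall>f\<in>F. \<forall>r. 0 < r \<and> r < R \<longrightarrow> (\<lambda>z. f (of_real r * z) / of_real r) \<in> G)"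

text \<open>
  The radius is a relation rather than a function, so that asserting its value includes the
  existence of a largest admissible number. The argument order follows $R_G(F)$.
\<close>

definition is_class_radius ::
    "(complex \<Rightarrow> complex) set \<Rightarrow> (complex \<Rightarrow> complex) set \<Rightarrow> real \<Rightarrow> bool" where
  "is_class_radius G F R \<longleftrightarrow>
     radius_admissible G F R \<and> (\<forall>R'. radius_admissible G F R' \<longrightarrow> R' \<le> R)"

end

theory Submission
  imports Defs
begin

text \<open>
  Every function in one of the classes factors on the disc as \<open>f z = z * \<phi> z\<close>, where \<open>\<phi>\<close> is a
  product of two or three functions with positive real part; in the second class one of them has
  real part above \<open>1 / 2\<close>. Hence \<open>z f'(z) / f(z) = 1 + z \<phi>'(z) / \<phi>(z)\<close>, and the last term is the
  sum of the terms \<open>z p'(z) / p(z)\<close> over the factors \<open>p\<close>. The invariant Schwarz lemma bounds such a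
  term by \<open>2 t / (1 - t\<^sup>2)\<close>, or by \<open>t / (1 - t)\<close> in the case of real part above \<open>1 / 2\<close>, where
  \<open>t = \<bar>z\<bar>\<close> (\<open>norm_log_deriv_class_P\<close>, \<open>norm_log_deriv_class_P_half\<close>). So \<open>z f'(z) / f(z)\<close> lies in
  the disc about \<open>1\<close> of radius \<open>M t\<close>, with \<open>M\<close> an explicit increasing majorant.

  The target domain is the image of the unit disc under \<open>1 + sin\<close>. Since \<open>\<bar>sin z\<bar> \<ge> \<bar>sin \<bar>z\<bar>\<bar>\<close>
  (\<open>sin_norm_le_norm_sin\<close>), the inverse branch \<open>Arcsin\<close> maps the disc of radius \<open>sin 1\<close> about \<open>0\<close>
  into the unit disc, so \<open>M r \<le> sin 1\<close> suffices for the dilation of \<open>f\<close> by \<open>r\<close> to be in the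
  target class. No larger disc about \<open>1\<close> will do: the real values of \<open>sin\<close> on the unit disc are all
  smaller than \<open>sin 1\<close> (\<open>sin_real_value_less\<close>).

  At positive real points the bounds become equalities when each factor of \<open>\<phi>\<close> is
  \<open>(1 + z) / (1 - z)\<close>, or \<open>1 / (1 - z)\<close> for the factor with real part above \<open>1 / 2\<close>. For these
  extremal functions \<open>z f'(z) / f(z)\<close> is real on the positive radius of the disc and leaves the
  target domain exactly where \<open>M t = sin 1\<close>. The radius is therefore the root of this equation
  (\<open>sine_starlike_radiusI\<close>). After clearing denominators the equation is quadratic, and the closed
  forms in the theorem are its positive root.
\<close>

section \<open>The sine function on the unit disc\<close>

text \<open>
  With \<open>z = x + \<i> y\<close> and \<open>r = \<bar>z\<bar>\<close>, the squared modulus of \<open>sin z\<close> is \<open>(sin x)\<^sup>2 + (sinh y)\<^sup>2\<close>, and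
  \<open>(sin r)\<^sup>2 - (sin x)\<^sup>2 = sin (r + x) * sin (r - x) \<le> r\<^sup>2 - x\<^sup>2 = y\<^sup>2 \<le> (sinh y)\<^sup>2\<close>.
\<close>

lemma sin_norm_le_norm_sin: "\<bar>sin (norm z)\<bar> \<le> norm (sin z)" for z :: complex
proof -
  define x y where "x = Re z" and "y = Im z"
  have sinh_ge: "t \<le> sinh t" if "0 \<le> t" for t :: real
  proof -
    have "(\<lambda>t. sinh t - t) 0 \<le> (\<lambda>t. sinh t - t) t"
      using that by (rule DERIV_nonneg_imp_nondecreasing)
        (auto intro!: exI derivative_eq_intros simp: cosh_real_ge_1)
    then show ?thesis by simp
  qed
  have "\<bar>y\<bar> \<le> \<bar>sinh y\<bar>"
    using sinh_ge[of "\<bar>y\<bar>"] by simp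
  then have sinh: "y\<^sup>2 \<le> (sinh y)\<^sup>2"
    by (simp add: abs_le_square_iff)
  have "(norm (sin z))\<^sup>2 = (sin x * cosh y)\<^sup>2 + (cos x * sinh y)\<^sup>2"
    by (simp add: cmod_power2 Re_sin Im_sin x_def y_def cosh_field_def sinh_field_def)
  also have "\<dots> = (sin x)\<^sup>2 + (sinh y)\<^sup>2"
    by (simp add: power_mult_distrib sinh_square_eq cos_squared_eq algebra_simps)
  finally have norm_sin: "(norm (sin z))\<^sup>2 = (sin x)\<^sup>2 + (sinh y)\<^sup>2" .
  define r where "r = norm z"
  have r: "r\<^sup>2 = x\<^sup>2 + y\<^sup>2"
    by (simp add: r_def x_def y_def cmod_power2)
  have "(sin r)\<^sup>2 - (sin x)\<^sup>2 = sin (r + x) * sin (r - x)"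
  proof -
    have "sin (r + x) * sin (r - x) = (sin r)\<^sup>2 * (cos x)\<^sup>2 - (cos r)\<^sup>2 * (sin x)\<^sup>2"
      unfolding sin_add sin_diff by (simp add: power2_eq_square algebra_simps)
    then show ?thesis by (simp only: cos_squared_eq) (simp add: algebra_simps)
  qed
  also have "\<dots> \<le> \<bar>r + x\<bar> * \<bar>r - x\<bar>"
  proof -
    have "sin (r + x) * sin (r - x) \<le> \<bar>sin (r + x)\<bar> * \<bar>sin (r - x)\<bar>"
      by (simp flip: abs_mult)
    also have "\<dots> \<le> \<bar>r + x\<bar> * \<bar>r - x\<bar>"
      by (intro mult_mono abs_sin_x_le_abs_x) auto
    finally show ?thesis .
  qed
  also have "\<dots> = \<bar>r\<^sup>2 - x\<^sup>2\<bar>"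
    by (simp add: abs_mult[symmetric] power2_eq_square algebra_simps)
  also have "\<dots> = y\<^sup>2"
    by (simp add: r)
  finally have "(sin r)\<^sup>2 \<le> (norm (sin z))\<^sup>2"
    using sinh norm_sin by linarith
  then show ?thesis
    using abs_le_square_iff[of "sin r" "norm (sin z)"] by (simp add: r_def)
qed

text \<open>
  A continuity argument: if \<open>Arcsin w\<close> were outside the unit disc, then \<open>Arcsin\<close> would have modulus
  exactly \<open>1\<close> at some point of the segment from \<open>0\<close> to \<open>w\<close>, and \<open>sin_norm_le_norm_sin\<close> would make
  the modulus of that point at least \<open>sin 1\<close>.
\<close>

lemma norm_Arcsin_less_1:
  assumes "norm w < sin 1"
  shows "norm (Arcsin w) < 1"
proof (rule ccontr)
  assume "\<not> norm (Arcsin w) < 1"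
  define g where "g = (\<lambda>t. norm (Arcsin (of_real t * w)))"
  have small: "norm (of_real t * w) < sin 1" if "0 \<le> t" "t \<le> 1" for t
    using that assms mult_left_le_one_le[of "norm w" t] by (auto simp: norm_mult)
  have "sin 1 < (1::real)"
    using sin_monotone_2pi[of 1 "pi / 2"] pi_gt3 by simp
  have Arcsin_cont: "continuous_on (ball 0 1) Arcsin"
  proof (rule continuous_on_Arcsin)
    fix z :: complex assume "z \<in> ball 0 1"
    then show "\<bar>Re z\<bar> < 1"
      using abs_Re_le_cmod[of z] by simp
  qed
  have "(\<lambda>t. of_real t * w) ` {0..1} \<subseteq> ball 0 1"
  proof (rule image_subsetI)
    fix t :: real assume "t \<in> {0..1}"
    then have "norm (of_real t * w) < sin 1" using small[of t] by simp
    then have "norm (of_real t * w) < 1" using \<open>sin 1 < 1\<close> by (rule less_trans)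
    then show "of_real t * w \<in> ball 0 1" by simp
  qed
  then have "continuous_on {0..1} (\<lambda>t. Arcsin (of_real t * w))"
    by (intro continuous_on_compose2[OF Arcsin_cont] continuous_intros)
  then have "continuous_on {0..1} g"
    unfolding g_def by (rule continuous_on_norm)
  moreover have "g 0 \<le> 1" "1 \<le> g 1"
    using \<open>\<not> norm (Arcsin w) < 1\<close> by (auto simp: g_def)
  ultimately obtain t where t: "0 \<le> t" "t \<le> 1" "g t = 1"
    using IVT'[of g 0 1 1] by auto
  then have "sin 1 \<le> norm (of_real t * w)"
    using sin_norm_le_norm_sin[of "Arcsin (of_real t * w)"] by (simp add: g_def)
  then show False
    using small t by force
qed

text \<open>
  The imaginary part of \<open>sin w\<close> is \<open>cos (Re w) * sinh (Im w)\<close> with a positive first factor, so a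
  real value of \<open>sin\<close> on the unit disc is taken at a real point, and \<open>sin\<close> increases on
  the interval from \<open>-1\<close> to \<open>1\<close>.
\<close>

lemma sin_real_value_less:
  fixes w :: complex
  assumes "norm w < 1" "sin w = of_real s"
  shows "s < sin 1"
proof -
  have "\<bar>Re w\<bar> < 1" using assms(1) abs_Re_le_cmod[of w] by linarith
  then have "cos (Re w) > 0"
    using pi_gt3 by (intro cos_gt_zero_pi) auto
  moreover have "Im (sin w) = 0" using assms(2) by simp
  ultimately have "sinh (Im w) = 0"
    by (simp add: Im_sin sinh_field_def)
  then have "Im w = 0" by simp
  then have "s = sin (Re w)"
    using assms(2) Re_sin[of w] by simp
  also have "\<dots> < sin 1"
    using \<open>\<bar>Re w\<bar> < 1\<close> pi_gt3 by (intro sin_monotone_2pi) auto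
  finally show ?thesis .
qed

section \<open>Logarithmic derivatives of functions with positive real part\<close>

text \<open>
  In the right half-plane, \<open>x\<close> is closer to \<open>y\<close> than to its mirror image \<open>- cnj y\<close>. The quotient
  is the conformal map of the half-plane onto the disc that sends \<open>y\<close> to \<open>0\<close>.
\<close>

lemma norm_half_plane_quotient_less_1:
  assumes "Re x > 0" "Re y > 0"
  shows "norm ((x - y) / (x + cnj y)) < 1"
proof -
  have "(Re x - Re y)\<^sup>2 < (Re x + Re y)\<^sup>2"
    using assms by (simp add: power2_eq_square algebra_simps)
  then have "(norm (x - y))\<^sup>2 < (norm (x + cnj y))\<^sup>2"
    by (simp add: cmod_power2)
  then have "norm (x - y) < norm (x + cnj y)"
    by (rule power2_less_imp_less) simp
  moreover from this have "norm (x + cnj y) > 0"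
    by (rule le_less_trans[OF norm_ge_zero])
  ultimately show ?thesis
    by (simp add: norm_divide)
qed

text \<open>
  Precomposing \<open>p\<close> with the disc automorphism taking \<open>0\<close> to \<open>a\<close>, and postcomposing it with the map
  of the half-plane taking \<open>p a\<close> to \<open>0\<close>, gives a self-map of the disc fixing \<open>0\<close>. The Schwarz lemma
  bounds its derivative at \<open>0\<close> by \<open>1\<close>; by the chain rule that derivative is
  \<open>p'(a) (1 - \<bar>a\<bar>\<^sup>2) / (2 Re (p a))\<close>.
\<close>

lemma Schwarz_Pick_half_plane:
  assumes hol: "p holomorphic_on unit_disc"
    and pos: "\<And>z. z \<in> unit_disc \<Longrightarrow> Re (p z) > 0"
    and a: "norm a < 1"
  shows "norm (deriv p a) \<le> 2 * Re (p a) / (1 - (norm a)\<^sup>2)"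
proof -
  define m where "m = Moebius_function 0 (- a)"
  define u where "u = (\<lambda>z. (p (m z) - p a) / (p (m z) + cnj (p a)))"
  have m_hol: "m holomorphic_on unit_disc"
    unfolding m_def using a by (intro Moebius_function_holomorphic) simp
  have m_disc: "m ` unit_disc \<subseteq> unit_disc"
    using a Moebius_function_norm_lt_1[of "- a"] by (auto simp: m_def)
  \<comment> \<open>Since \<open>m\<close> is the map for the parameter \<open>- a\<close>, it sends \<open>0\<close> to \<open>a\<close>.\<close>
  have m_eq: "m = (\<lambda>z. (z + a) / (1 + cnj a * z))"
    by (auto simp: m_def Moebius_function_simple)
  then have m0: "m 0 = a" by simp
  have a_disc: "a \<in> unit_disc" using a by simp
  have pm_pos: "Re (p (m z)) > 0" if "z \<in> unit_disc" for z
    using m_disc that by (intro pos) blast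
  have nz: "p (m z) + cnj (p a) \<noteq> 0" if "z \<in> unit_disc" for z
    using pm_pos[OF that] pos[OF a_disc] by (auto simp: complex_eq_iff)
  have pm_hol: "(\<lambda>z. p (m z)) holomorphic_on unit_disc"
    using holomorphic_on_compose_gen[OF m_hol hol m_disc] by (simp add: o_def)
  have u_hol: "u holomorphic_on unit_disc"
    unfolding u_def using nz by (intro holomorphic_intros pm_hol) auto
  have u_less: "norm (u z) < 1" if "norm z < 1" for z
    unfolding u_def
    using that pm_pos pos[OF a_disc] by (intro norm_half_plane_quotient_less_1) auto
  have "norm (deriv u 0) \<le> 1"
    by (rule Schwarz_Lemma(2)[OF u_hol _ u_less, where \<xi> = 0]) (auto simp: u_def m0)
  have "(m has_field_derivative (1 - a * cnj a)) (at 0)"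
    unfolding m_eq by (auto intro!: derivative_eq_intros)
  then have m_der: "(m has_field_derivative of_real (1 - (norm a)\<^sup>2)) (at 0)"
    by (simp only: of_real_diff of_real_1 complex_norm_square)
  have p_der: "(p has_field_derivative deriv p a) (at (m 0))"
    unfolding m0 using hol a_disc by (intro holomorphic_derivI) auto
  have pm_der: "((\<lambda>z. p (m z)) has_field_derivative deriv p a * of_real (1 - (norm a)\<^sup>2)) (at 0)"
    using DERIV_chain2[OF p_der m_der] .
  have re: "p a + cnj (p a) = of_real (2 * Re (p a))"
    by (simp add: complex_eq_iff)
  have "0 < Re (p a)" using a_disc by (rule pos)
  have "(u has_field_derivative deriv p a * of_real (1 - (norm a)\<^sup>2) / of_real (2 * Re (p a))) (at 0)"
    unfolding u_def
    by (rule derivative_eq_intros pm_der refl)+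
       (use re \<open>0 < Re (p a)\<close> nz[of 0] in \<open>auto simp: m0 divide_simps\<close>)
  then have "deriv u 0 = deriv p a * of_real (1 - (norm a)\<^sup>2) / of_real (2 * Re (p a))"
    by (rule DERIV_imp_deriv)
  moreover have "0 < 1 - (norm a)\<^sup>2"
    using a by (simp add: power_less_one_iff abs_square_less_1)
  ultimately have "norm (deriv u 0) = norm (deriv p a) * (1 - (norm a)\<^sup>2) / (2 * Re (p a))"
    using \<open>0 < Re (p a)\<close> by (simp only: norm_mult norm_divide norm_of_real)
  then show ?thesis
    using \<open>norm (deriv u 0) \<le> 1\<close> \<open>0 < Re (p a)\<close> \<open>0 < 1 - (norm a)\<^sup>2\<close>
    by (simp add: pos_divide_le_eq pos_le_divide_eq)
qed

text \<open>
  The factor \<open>z\<close> makes this the derivative of \<open>ln \<phi>\<close> with respect to \<open>ln z\<close>; it takes products to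
  sums and is compatible with the dilations of the disc.
\<close>

definition log_deriv :: "(complex \<Rightarrow> complex) \<Rightarrow> complex \<Rightarrow> complex" where
  "log_deriv \<phi> z = z * deriv \<phi> z / \<phi> z"

lemma log_deriv_mult:
  assumes "\<phi> holomorphic_on unit_disc" "\<psi> holomorphic_on unit_disc" "z \<in> unit_disc"
    and "\<phi> z \<noteq> 0" "\<psi> z \<noteq> 0"
  shows "log_deriv (\<lambda>z. \<phi> z * \<psi> z) z = log_deriv \<phi> z + log_deriv \<psi> z"
proof -
  have "\<phi> field_differentiable at z" "\<psi> field_differentiable at z"
    using assms(1-3) by (auto intro: holomorphic_on_imp_differentiable_at)
  then show ?thesis
    using assms(4,5) by (simp add: log_deriv_def field_simps)
qed

lemma class_PD:
  assumes "p \<in> class_P"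
  shows "p holomorphic_on unit_disc" "p 0 = 1" "z \<in> unit_disc \<Longrightarrow> Re (p z) > 0"
    "z \<in> unit_disc \<Longrightarrow> p z \<noteq> 0"
  using assms by (force simp: class_P_def analytic_on_open)+

lemma norm_log_deriv_class_P:
  assumes p: "p \<in> class_P" and z: "z \<in> unit_disc"
  shows "norm (log_deriv p z) \<le> 2 * norm z / (1 - (norm z)\<^sup>2)"
proof -
  have "0 < 1 - (norm z)\<^sup>2" using z by (simp add: abs_square_less_1)
  have "norm (deriv p z) \<le> 2 * Re (p z) / (1 - (norm z)\<^sup>2)"
    using z by (intro Schwarz_Pick_half_plane class_PD[OF p]) auto
  also have "\<dots> \<le> 2 * norm (p z) / (1 - (norm z)\<^sup>2)"
    using \<open>0 < 1 - (norm z)\<^sup>2\<close> complex_Re_le_cmod[of "p z"] by (intro divide_right_mono) auto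
  finally have "norm z * norm (deriv p z) \<le> norm z * (2 * norm (p z) / (1 - (norm z)\<^sup>2))"
    by (intro mult_left_mono) auto
  then show ?thesis
    using class_PD(4)[OF p z]
    by (simp add: log_deriv_def norm_mult norm_divide divide_le_eq mult_ac)
qed

text \<open>
  That \<open>q\<close> has real part above \<open>1 / 2\<close> means that \<open>q z\<close> is closer to \<open>1\<close> than to \<open>0\<close>, that is,
  \<open>q = 1 / (1 - w)\<close> with \<open>w\<close> a self-map of the disc fixing \<open>0\<close>. The invariant Schwarz lemma for
  \<open>2 q - 1\<close> bounds \<open>q'\<close> in terms of \<open>2 Re (q z) - 1 = \<bar>q z\<bar>\<^sup>2 (1 - \<bar>w z\<bar>\<^sup>2)\<close>. The two estimates
  \<open>\<bar>q z\<bar> (1 - \<bar>w z\<bar>) \<le> 1\<close> and \<open>\<bar>w z\<bar> \<le> \<bar>z\<bar>\<close> bound this by \<open>\<bar>q z\<bar> (1 + \<bar>z\<bar>)\<close>, and the factor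
  \<open>1 + \<bar>z\<bar>\<close> cancels against \<open>1 - \<bar>z\<bar>\<^sup>2\<close>.
\<close>

lemma norm_log_deriv_class_P_half:
  assumes q: "q \<in> class_P_half" and z: "z \<in> unit_disc"
  shows "norm (log_deriv q z) \<le> norm z / (1 - norm z)"
proof -
  define w where "w = (\<lambda>z. 1 - 1 / q z)"
  have qP: "q \<in> class_P" and half: "\<And>z. z \<in> unit_disc \<Longrightarrow> Re (q z) > 1 / 2"
    using q by (auto simp: class_P_half_def)
  note q_hol = class_PD(1)[OF qP] and q_nz = class_PD(4)[OF qP]
  have gap: "(norm (q z))\<^sup>2 - (norm (q z - 1))\<^sup>2 = 2 * Re (q z) - 1" for z
    unfolding cmod_power2 by (simp add: power2_eq_square algebra_simps)
  have w_eq: "norm (w z) = norm (q z - 1) / norm (q z)" if "z \<in> unit_disc" for z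
    using q_nz[OF that] by (simp add: w_def diff_divide_distrib flip: norm_divide)
  have w_less: "norm (w z) < 1" if "norm z < 1" for z
  proof -
    have zd: "z \<in> unit_disc" using that by simp
    have "(norm (q z - 1))\<^sup>2 < (norm (q z))\<^sup>2"
      using gap[of z] half[OF zd] by simp
    then have "norm (q z - 1) < norm (q z)"
      by (rule power2_less_imp_less) simp
    then show ?thesis
      using q_nz[OF zd] by (simp add: w_eq[OF zd])
  qed
  have "w holomorphic_on unit_disc"
    unfolding w_def using q_nz by (intro holomorphic_intros q_hol) auto
  then have w_le: "norm (w z) \<le> norm z"
    by (rule Schwarz_Lemma(1)[OF _ _ w_less]) (use z class_PD(2)[OF qP] in \<open>auto simp: w_def\<close>)
  have "(\<lambda>z. 2 * q z - 1) holomorphic_on unit_disc"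
    by (intro holomorphic_intros q_hol)
  then have "norm (deriv (\<lambda>z. 2 * q z - 1) z) \<le> 2 * Re (2 * q z - 1) / (1 - (norm z)\<^sup>2)"
    by (rule Schwarz_Pick_half_plane) (use z half in force)+
  moreover have "deriv (\<lambda>z. 2 * q z - 1) z = 2 * deriv q z"
    by (rule DERIV_imp_deriv)
       (use z in \<open>auto intro!: derivative_eq_intros holomorphic_derivI[OF q_hol]\<close>)
  ultimately have "2 * norm (deriv q z) \<le> 2 * ((2 * Re (q z) - 1) / (1 - (norm z)\<^sup>2))"
    by (simp add: norm_mult right_diff_distrib)
  then have q': "norm (deriv q z) \<le> (2 * Re (q z) - 1) / (1 - (norm z)\<^sup>2)"
    by (rule mult_left_le_imp_le) simp
  define n where "n = norm (q z)"
  define v where "v = norm (w z)"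
  define r where "r = norm z"
  have n: "0 < n" using q_nz[OF z] by (simp add: n_def)
  have r: "0 \<le> r" "r < 1" using z by (auto simp: r_def)
  have v: "0 \<le> v" "v < 1" "v \<le> r" using w_less w_le z by (auto simp: v_def r_def)
  have "n * (1 - v) \<le> 1"
  proof -
    have "1 = norm (q z * (1 - w z))" using q_nz[OF z] by (simp add: w_def)
    also have "\<dots> \<ge> n * (1 - v)"
      unfolding norm_mult n_def v_def
      using norm_triangle_ineq2[of 1 "w z"] by (intro mult_left_mono) auto
    finally show ?thesis .
  qed
  have "2 * Re (q z) - 1 = n\<^sup>2 - (v * n)\<^sup>2"
    using gap[of z] w_eq[OF z] q_nz[OF z] by (simp add: n_def v_def)
  also have "\<dots> = n * (1 + v) * (n * (1 - v))"
    by (simp add: power2_eq_square algebra_simps)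
  also have "\<dots> \<le> n * (1 + v) * 1"
    using n v \<open>n * (1 - v) \<le> 1\<close> by (intro mult_left_mono) auto
  also have "\<dots> \<le> n * (1 + r)"
    using n v by simp
  finally have "2 * Re (q z) - 1 \<le> n * (1 + r)" .
  have "1 - r\<^sup>2 = (1 + r) * (1 - r)"
    by (simp add: power2_eq_square algebra_simps)
  moreover have "0 < (1 + r) * (1 - r)" using r by simp
  ultimately have "norm (deriv q z) \<le> n * (1 + r) / ((1 + r) * (1 - r))"
    using q' \<open>2 * Re (q z) - 1 \<le> n * (1 + r)\<close>
    by (smt (verit) divide_right_mono r_def)
  also have "\<dots> = n / (1 - r)" using r by simp
  finally have "r * norm (deriv q z) \<le> r * (n / (1 - r))"
    using r by (intro mult_left_mono)
  then show ?thesis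
    using n by (simp add: log_deriv_def norm_mult norm_divide divide_le_eq mult_ac
        flip: n_def r_def)
qed

text \<open>
  Majorants add up under products (\<open>log_deriv_majorized_mult\<close>), so a bound for each class can be read
  off from its factors. The condition \<open>\<phi> 0 = 1\<close> is the normalization \<open>f'(0) = 1\<close> of
  \<open>f z = z * \<phi> z\<close>.
\<close>

definition log_deriv_majorized :: "(complex \<Rightarrow> complex) \<Rightarrow> (real \<Rightarrow> real) \<Rightarrow> bool" where
  "log_deriv_majorized \<phi> M \<longleftrightarrow> \<phi> holomorphic_on unit_disc \<and> \<phi> 0 = 1 \<and>
     (\<forall>z\<in>unit_disc. \<phi> z \<noteq> 0 \<and> norm (log_deriv \<phi> z) \<le> M (norm z))"

lemma log_deriv_majorized_mult:
  assumes "log_deriv_majorized \<phi> M" "log_deriv_majorized \<psi> N"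
  shows "log_deriv_majorized (\<lambda>z. \<phi> z * \<psi> z) (\<lambda>t. M t + N t)"
  using assms unfolding log_deriv_majorized_def
  by (auto simp: log_deriv_mult intro!: holomorphic_intros norm_triangle_mono)

lemma class_P_majorized:
  "p \<in> class_P \<Longrightarrow> log_deriv_majorized p (\<lambda>t. 2 * t / (1 - t\<^sup>2))"
  using class_PD norm_log_deriv_class_P by (simp add: log_deriv_majorized_def)

lemma class_P_half_majorized:
  "q \<in> class_P_half \<Longrightarrow> log_deriv_majorized q (\<lambda>t. t / (1 - t))"
  using class_PD norm_log_deriv_class_P_half
  by (simp add: log_deriv_majorized_def class_P_half_def)

section \<open>Factorization of the classes\<close>

text \<open>
  Filling in singularities is a local limit, and near any point of the disc, the point itself
  removed, \<open>k\<close> agrees with the continuous function \<open>h\<close>. This evaluates all the filled-in quotients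
  below whose analytic continuation to the origin is known explicitly.
\<close>

lemma remove_sings_eq_on_disc:
  assumes "h holomorphic_on unit_disc" "\<And>z. z \<in> unit_disc \<Longrightarrow> z \<noteq> 0 \<Longrightarrow> k z = h z"
    and z: "z \<in> unit_disc"
  shows "remove_sings k z = h z"
proof -
  have "eventually (\<lambda>u. u \<in> unit_disc - {0}) (at z)"
  proof (cases "z = 0")
    case True
    then show ?thesis
      using eventually_at_in_open[of unit_disc z] by simp
  next
    case False
    then show ?thesis
      using z by (intro eventually_at_in_open') auto
  qed
  then have "eventually (\<lambda>u. k u = h u) (at z)"
    by eventually_elim (use assms(2) in auto)
  then have "remove_sings k z = remove_sings h z"
    by (intro remove_sings_cong) auto
  also have "\<dots> = h z"
    using assms(1) z
    by (intro remove_sings_at_analytic)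
      (meson analytic_on_open analytic_on_subset empty_subsetI insert_subset open_ball)
  finally show ?thesis .
qed

lemma holomorphic_on_disc_cong:
  "(\<And>z. z \<in> unit_disc \<Longrightarrow> k z = h z) \<Longrightarrow> k holomorphic_on unit_disc \<longleftrightarrow> h holomorphic_on unit_disc"
  by (rule holomorphic_cong) auto

lemma class_P_cong:
  assumes "\<And>z. z \<in> unit_disc \<Longrightarrow> k z = h z"
  shows "k \<in> class_P \<longleftrightarrow> h \<in> class_P" "k \<in> class_P_half \<longleftrightarrow> h \<in> class_P_half"
  using assms holomorphic_on_disc_cong[of k h, OF assms]
  by (auto simp: class_P_half_def class_P_def analytic_on_open)

lemma remove_sings_in_class_P:
  assumes "\<And>z. z \<in> unit_disc \<Longrightarrow> z \<noteq> 0 \<Longrightarrow> k z = h z"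
  shows "h \<in> class_P \<Longrightarrow> remove_sings k \<in> class_P"
    and "h \<in> class_P_half \<Longrightarrow> remove_sings k \<in> class_P_half"
proof -
  have eq: "remove_sings k z = h z" if "h \<in> class_P" "z \<in> unit_disc" for z
    using remove_sings_eq_on_disc[of h k z, OF class_PD(1)] assms that by blast
  show "h \<in> class_P \<Longrightarrow> remove_sings k \<in> class_P"
    using class_P_cong(1)[of "remove_sings k" h] eq by blast
  show "h \<in> class_P_half \<Longrightarrow> remove_sings k \<in> class_P_half"
    using class_P_cong(2)[of "remove_sings k" h] eq by (simp add: class_P_half_def)
qed

lemma class_AD:
  assumes "f \<in> class_A"
  shows "f holomorphic_on unit_disc" "f 0 = 0"
  using assms by (auto simp: class_A_def analytic_on_open)

lemma times_in_class_A:
  assumes "\<phi> holomorphic_on unit_disc" "\<phi> 0 = 1"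
  shows "(\<lambda>z. z * \<phi> z) \<in> class_A"
proof -
  have "((\<lambda>z. z * \<phi> z) has_field_derivative 1) (at 0)"
    using assms(2)
    by (auto intro!: derivative_eq_intros holomorphic_derivI[OF assms(1)])
  then have "deriv (\<lambda>z. z * \<phi> z) 0 = 1"
    by (rule DERIV_imp_deriv)
  then show ?thesis
    using assms(1) by (auto simp: class_A_def analytic_on_open intro!: holomorphic_intros)
qed

text \<open>
  Off the origin the quotient is analytic, so filling in changes nothing. At the origin both sides
  vanish, whatever the value of the filled-in quotient there.
\<close>

lemma remove_sings_quotient_factor:
  assumes "f holomorphic_on unit_disc" "g holomorphic_on unit_disc" "f 0 = 0" "g 0 = 0"
    and "\<And>z. z \<in> unit_disc \<Longrightarrow> z \<noteq> 0 \<Longrightarrow> g z \<noteq> 0"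
    and z: "z \<in> unit_disc"
  shows "f z = g z * remove_sings (\<lambda>z. f z / g z) z"
proof (cases "z = 0")
  case False
  have "(\<lambda>z. f z / g z) holomorphic_on unit_disc - {0}"
    using assms by (intro holomorphic_on_divide) (auto elim: holomorphic_on_subset)
  then have "(\<lambda>z. f z / g z) analytic_on unit_disc - {0}"
    by (simp add: analytic_on_open open_delete)
  then have "(\<lambda>z. f z / g z) analytic_on {z}"
    using z False by (elim analytic_on_subset) auto
  then show ?thesis
    using assms(5)[OF z False] by simp
qed (use assms in auto)

lemma class_A_factor:
  assumes "g \<in> class_A" "p \<in> class_P" "z \<in> unit_disc"
  shows "g z = z * (p z * remove_sings (\<lambda>z. g z / (z * p z)) z)"
  using remove_sings_quotient_factor[of g "\<lambda>z. z * p z" z] class_AD[OF assms(1)]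
    class_PD(1,4)[OF assms(2)] assms(3)
  by (simp add: holomorphic_on_mult mult.assoc)

text \<open>
  By the factorization of \<open>g\<close>, its only zero in the disc is the origin. This makes \<open>f / g\<close> analytic
  on the punctured disc, so that \<open>f\<close> factors through \<open>g\<close>.
\<close>

lemma class_A_factor2:
  assumes f: "f \<in> class_A" and g: "g \<in> class_A" and p: "p \<in> class_P"
    and q: "remove_sings (\<lambda>z. g z / (z * p z)) \<in> class_P"
    and z: "z \<in> unit_disc"
  shows "f z = z * (p z * (remove_sings (\<lambda>z. g z / (z * p z)) z * remove_sings (\<lambda>z. f z / g z) z))"
proof -
  have "g z \<noteq> 0" if "z \<in> unit_disc" "z \<noteq> 0" for z
    using class_A_factor[OF g p that(1)] class_PD(4)[OF p that(1)] class_PD(4)[OF q that(1)] that(2)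
    by simp
  then have "f z = g z * remove_sings (\<lambda>z. f z / g z) z"
    using class_AD[OF f] class_AD[OF g] z by (intro remove_sings_quotient_factor)
  then show ?thesis
    using class_A_factor[OF g p z] by (simp add: mult.assoc)
qed

lemma class_G1_majorized:
  assumes "f \<in> class_G1"
  shows "\<exists>\<phi>. log_deriv_majorized \<phi>
      (\<lambda>t. 2 * t / (1 - t\<^sup>2) + (2 * t / (1 - t\<^sup>2) + 2 * t / (1 - t\<^sup>2))) \<and>
    (\<forall>z\<in>unit_disc. f z = z * \<phi> z)"
proof -
  from assms obtain g p where f: "f \<in> class_A" and g: "g \<in> class_A" and p: "p \<in> class_P"
    and h: "remove_sings (\<lambda>z. f z / g z) \<in> class_P"
    and q: "remove_sings (\<lambda>z. g z / (z * p z)) \<in> class_P"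
    by (auto simp: class_G1_def)
  show ?thesis
    using log_deriv_majorized_mult[OF class_P_majorized[OF p]
        log_deriv_majorized_mult[OF class_P_majorized[OF q] class_P_majorized[OF h]]]
      class_A_factor2[OF f g p q] by blast
qed

lemma class_G2_majorized:
  assumes "f \<in> class_G2"
  shows "\<exists>\<phi>. log_deriv_majorized \<phi>
      (\<lambda>t. 2 * t / (1 - t\<^sup>2) + (t / (1 - t) + 2 * t / (1 - t\<^sup>2))) \<and>
    (\<forall>z\<in>unit_disc. f z = z * \<phi> z)"
proof -
  from assms obtain g p where f: "f \<in> class_A" and g: "g \<in> class_A" and p: "p \<in> class_P"
    and h: "remove_sings (\<lambda>z. f z / g z) \<in> class_P"
    and q: "remove_sings (\<lambda>z. g z / (z * p z)) \<in> class_P_half"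
    by (auto simp: class_G2_def)
  then have qP: "remove_sings (\<lambda>z. g z / (z * p z)) \<in> class_P"
    by (simp add: class_P_half_def)
  show ?thesis
    using log_deriv_majorized_mult[OF class_P_majorized[OF p]
        log_deriv_majorized_mult[OF class_P_half_majorized[OF q] class_P_majorized[OF h]]]
      class_A_factor2[OF f g p qP] by blast
qed

lemma class_G3_majorized:
  assumes "f \<in> class_G3"
  shows "\<exists>\<phi>. log_deriv_majorized \<phi> (\<lambda>t. 2 * t / (1 - t\<^sup>2) + 2 * t / (1 - t\<^sup>2)) \<and>
    (\<forall>z\<in>unit_disc. f z = z * \<phi> z)"
proof -
  from assms obtain p where f: "f \<in> class_A" and p: "p \<in> class_P"
    and q: "remove_sings (\<lambda>z. f z / (z * p z)) \<in> class_P"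
    by (auto simp: class_G3_def)
  show ?thesis
    using log_deriv_majorized_mult[OF class_P_majorized[OF p] class_P_majorized[OF q]]
      class_A_factor[OF f p] by blast
qed

section \<open>Radii of sine-starlikeness\<close>

text \<open>
  The dilation \<open>F\<close> equals \<open>z * \<phi> (r z)\<close> on the disc, so its starlikeness quotient is
  \<open>1 + log_deriv \<phi>\<close> evaluated at \<open>r z\<close>. This function is analytic at the origin too, and hence is
  what filling in the singularity there produces.
\<close>

lemma rescaled_starlike_quotient:
  assumes hol: "\<phi> holomorphic_on unit_disc"
    and nz: "\<And>z. z \<in> unit_disc \<Longrightarrow> \<phi> z \<noteq> 0"
    and f: "\<And>z. z \<in> unit_disc \<Longrightarrow> f z = z * \<phi> z"
    and r: "0 < r" "r < 1"
  defines "F \<equiv> \<lambda>z. f (of_real r * z) / of_real r"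
  shows "z \<in> unit_disc \<Longrightarrow>
      remove_sings (\<lambda>z. z * deriv F z / F z) z = 1 + log_deriv \<phi> (of_real r * z)"
    and "(\<lambda>z. 1 + log_deriv \<phi> (of_real r * z)) holomorphic_on unit_disc"
    and "\<phi> 0 = 1 \<Longrightarrow> F \<in> class_A"
proof -
  have rz: "of_real r * z \<in> unit_disc" if "z \<in> unit_disc" for z
    using that r mult_strict_mono[of r 1 "norm z" 1] by (simp add: norm_mult)
  have scale_hol: "(\<lambda>z. g (of_real r * z)) holomorphic_on unit_disc"
    if "g holomorphic_on unit_disc" for g
  proof -
    have "(\<lambda>z. of_real r * z) ` unit_disc \<subseteq> unit_disc"
      using rz by blast
    moreover have "(\<lambda>z. of_real r * z) holomorphic_on unit_disc"
      by (intro holomorphic_intros)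
    ultimately show ?thesis
      using holomorphic_on_compose_gen[of "\<lambda>z. of_real r * z" unit_disc g unit_disc] that
      by (simp add: o_def)
  qed
  have F: "F z = z * \<phi> (of_real r * z)" if "z \<in> unit_disc" for z
    using f[OF rz[OF that]] r by (simp add: F_def)
  have deriv_F: "deriv F z = \<phi> (of_real r * z) + z * (of_real r * deriv \<phi> (of_real r * z))"
    if "z \<in> unit_disc" for z
  proof -
    have "(\<phi> has_field_derivative deriv \<phi> (of_real r * z)) (at (of_real r * z))"
      using rz[OF that] by (intro holomorphic_derivI[OF hol]) auto
    moreover have "((\<lambda>z. of_real r * z) has_field_derivative of_real r) (at z)"
      by (auto intro!: derivative_eq_intros)
    ultimately have "((\<lambda>z. \<phi> (of_real r * z)) has_field_derivative
        deriv \<phi> (of_real r * z) * of_real r) (at z)"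
      by (rule DERIV_chain2)
    then have "((\<lambda>z. z * \<phi> (of_real r * z)) has_field_derivative
        \<phi> (of_real r * z) + z * (of_real r * deriv \<phi> (of_real r * z))) (at z)"
      by (auto intro!: derivative_eq_intros)
    then have "(F has_field_derivative
        \<phi> (of_real r * z) + z * (of_real r * deriv \<phi> (of_real r * z))) (at z)"
      by (rule has_field_derivative_transform_within_open[where S = unit_disc])
         (use that F in auto)
    then show ?thesis by (rule DERIV_imp_deriv)
  qed
  have "log_deriv \<phi> holomorphic_on unit_disc"
    unfolding log_deriv_def using nz by (intro holomorphic_intros hol) auto
  then show quot_hol: "(\<lambda>z. 1 + log_deriv \<phi> (of_real r * z)) holomorphic_on unit_disc"
    by (intro holomorphic_on_add holomorphic_on_const scale_hol)
  show "remove_sings (\<lambda>z. z * deriv F z / F z) z = 1 + log_deriv \<phi> (of_real r * z)"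
    if z: "z \<in> unit_disc"
  proof (rule remove_sings_eq_on_disc[OF quot_hol _ z])
    fix z assume "z \<in> unit_disc" "z \<noteq> 0"
    then show "z * deriv F z / F z = 1 + log_deriv \<phi> (of_real r * z)"
      using nz[OF rz] by (simp add: F deriv_F log_deriv_def field_simps)
  qed
  assume "\<phi> 0 = 1"
  then have A: "(\<lambda>z. z * \<phi> (of_real r * z)) \<in> class_A"
    by (intro times_in_class_A scale_hol hol) auto
  have "F holomorphic_on unit_disc"
    using class_AD(1)[OF A] holomorphic_on_disc_cong[of F, OF F] by blast
  moreover have "F 0 = 0" "deriv F 0 = 1"
    using F[of 0] deriv_F[of 0] \<open>\<phi> 0 = 1\<close> by auto
  ultimately show "F \<in> class_A"
    by (simp add: class_A_def analytic_on_open)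
qed

lemma subordinate_one_plus_sinI:
  assumes hol: "h holomorphic_on unit_disc" and "h 0 = 1"
    and less: "\<And>z. z \<in> unit_disc \<Longrightarrow> norm (h z - 1) < sin 1"
  shows "h \<prec>\<^sub>s (\<lambda>z. 1 + sin z)"
  unfolding subordinate_def
proof (intro conjI exI[of _ "\<lambda>z. Arcsin (h z - 1)"] ballI)
  have "\<bar>Re (h z - 1)\<bar> < 1" if "z \<in> unit_disc" for z
    using less[OF that] sin_le_one[of "1::real"] abs_Re_le_cmod[of "h z - 1"] by linarith
  then have "Arcsin holomorphic_on (\<lambda>z. h z - 1) ` unit_disc"
    by (intro holomorphic_on_Arcsin) auto
  moreover have "(\<lambda>z. h z - 1) holomorphic_on unit_disc"
    by (intro holomorphic_intros hol)
  ultimately have "(\<lambda>z. Arcsin (h z - 1)) holomorphic_on unit_disc"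
    using holomorphic_on_compose[of "\<lambda>z. h z - 1" unit_disc Arcsin] by (simp add: o_def)
  then show "(\<lambda>z. Arcsin (h z - 1)) analytic_on unit_disc"
    by (simp add: analytic_on_open)
  show "(\<lambda>z. Arcsin (h z - 1)) ` unit_disc \<subseteq> unit_disc"
    using norm_Arcsin_less_1 less by auto
  show "h analytic_on unit_disc"
    using hol by (simp add: analytic_on_open)
  show "(\<lambda>z::complex. 1 + sin z) analytic_on unit_disc"
    by (intro analytic_intros)
  show "Arcsin (h 0 - 1) = 0"
    using \<open>h 0 = 1\<close> by simp
qed simp

text \<open>
  The majorant \<open>M\<close> keeps \<open>z f'(z) / f(z) - 1\<close> inside the disc of radius \<open>sin 1\<close> as long as
  \<open>\<bar>z\<bar> < R\<close>, which makes \<open>R\<close> admissible. For a larger number, the extremal function \<open>z * \<psi> z\<close> yields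
  at some real point \<open>x > R\<close> the value \<open>1 + M x\<close> with \<open>M x \<ge> sin 1\<close>, which \<open>1 + sin\<close> does not take
  on the disc.
\<close>

theorem sine_starlike_radiusI:
  assumes R: "0 < R" "R < 1"
    and M: "\<And>t. 0 \<le> t \<Longrightarrow> t < 1 \<Longrightarrow> M t < sin 1 \<longleftrightarrow> t < R"
    and bound: "\<And>f. f \<in> F \<Longrightarrow>
      \<exists>\<phi>. log_deriv_majorized \<phi> M \<and> (\<forall>z\<in>unit_disc. f z = z * \<phi> z)"
    and extremal: "(\<lambda>z. z * \<psi> z) \<in> F" "\<psi> holomorphic_on unit_disc"
      "\<And>z. z \<in> unit_disc \<Longrightarrow> \<psi> z \<noteq> 0"
      "\<And>x. 0 < x \<Longrightarrow> x < 1 \<Longrightarrow> log_deriv \<psi> (of_real x) = of_real (M x)"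
  shows "is_class_radius class_S_sin F R"
  unfolding is_class_radius_def
proof (intro conjI allI impI)
  show "radius_admissible class_S_sin F R"
    unfolding radius_admissible_def
  proof (intro conjI R ballI allI impI)
    fix f and r :: real
    assume "f \<in> F" and r: "0 < r \<and> r < R"
    define G where "G = (\<lambda>z. f (of_real r * z) / of_real r)"
    obtain \<phi> where hol: "\<phi> holomorphic_on unit_disc" and "\<phi> 0 = 1"
      and nz: "\<And>z. z \<in> unit_disc \<Longrightarrow> \<phi> z \<noteq> 0"
      and f: "\<And>z. z \<in> unit_disc \<Longrightarrow> f z = z * \<phi> z"
      and le: "\<And>z. z \<in> unit_disc \<Longrightarrow> norm (log_deriv \<phi> z) \<le> M (norm z)"
      using bound[OF \<open>f \<in> F\<close>] unfolding log_deriv_majorized_def by blast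
    have r01: "0 < r" "r < 1" using r R by auto
    define h where "h = (\<lambda>z. 1 + log_deriv \<phi> (of_real r * z))"
    have h_hol: "h holomorphic_on unit_disc"
      unfolding h_def
      by (rule rescaled_starlike_quotient(2)[OF hol]) (use nz f r01 in auto)
    have eq: "remove_sings (\<lambda>z. z * deriv G z / G z) z = h z" if "z \<in> unit_disc" for z
      unfolding G_def h_def
      by (rule rescaled_starlike_quotient(1)[OF hol]) (use nz f r01 that in auto)
    have "norm (h z - 1) < sin 1" if "z \<in> unit_disc" for z
    proof -
      have "r * norm z \<le> r"
        by (rule mult_left_le) (use that r in auto)
      then have "r * norm z < R"
        using r by linarith
      moreover from this have "of_real r * z \<in> unit_disc"
        using r R by (simp add: norm_mult)
      ultimately show ?thesis
        using le[of "of_real r * z"] M[of "r * norm z"] r R by (simp add: h_def norm_mult)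
    qed
    then have "h \<prec>\<^sub>s (\<lambda>z. 1 + sin z)"
      using h_hol by (intro subordinate_one_plus_sinI) (auto simp: h_def log_deriv_def)
    then have "remove_sings (\<lambda>z. z * deriv G z / G z) \<prec>\<^sub>s (\<lambda>z. 1 + sin z)"
      using eq holomorphic_on_disc_cong[of "remove_sings _" h, OF eq]
      by (simp add: subordinate_def analytic_on_open)
    moreover have "G \<in> class_A"
      unfolding G_def
      by (rule rescaled_starlike_quotient(3)[OF hol])
         (use nz f r01 \<open>\<phi> 0 = 1\<close> in auto)
    ultimately show "(\<lambda>z. f (of_real r * z) / of_real r) \<in> class_S_sin"
      by (simp add: class_S_sin_def G_def)
  qed
next
  fix R' assume adm: "radius_admissible class_S_sin F R'"
  show "R' \<le> R"
  proof (rule ccontr)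
    assume "\<not> R' \<le> R"
    then obtain r where r: "R < r" "r < R'"
      using dense[of R R'] by auto
    \<comment> \<open>The dilation by \<open>r\<close> moves \<open>x\<close> to \<open>x / r\<close>, which is inside the disc.\<close>
    obtain x where x: "R < x" "x < r"
      using dense r by blast
    have r01: "0 < r" "r < 1"
      using r R adm by (auto simp: radius_admissible_def)
    define G where "G = (\<lambda>z. of_real r * z * \<psi> (of_real r * z) / of_real r)"
    define z where "z = complex_of_real (x / r)"
    have z: "z \<in> unit_disc" "of_real r * z = of_real x"
      using x r01 R by (auto simp: z_def norm_divide)
    have "\<forall>f\<in>F. \<forall>r. 0 < r \<and> r < R' \<longrightarrow> (\<lambda>z. f (of_real r * z) / of_real r) \<in> class_S_sin"
      using adm by (simp add: radius_admissible_def)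
    from this[rule_format, OF extremal(1), of r] have "G \<in> class_S_sin"
      using r r01 by (simp only: G_def)
    then obtain v where v: "v ` unit_disc \<subseteq> unit_disc"
      "\<And>z. z \<in> unit_disc \<Longrightarrow> remove_sings (\<lambda>z. z * deriv G z / G z) z = 1 + sin (v z)"
      by (auto simp only: class_S_sin_def subordinate_def mem_Collect_eq)
    define w where "w = v z"
    have w: "norm w < 1" "remove_sings (\<lambda>z. z * deriv G z / G z) z = 1 + sin w"
      using v(1) v(2)[OF z(1)] z(1) by (auto simp: w_def image_subset_iff)
    have "remove_sings (\<lambda>z. z * deriv G z / G z) z = 1 + log_deriv \<psi> (of_real r * z)"
      unfolding G_def
      by (rule rescaled_starlike_quotient(1)[OF extremal(2), where f = "\<lambda>z. z * \<psi> z"])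
         (use extremal(3) r01 z in auto)
    then have "sin w = of_real (M x)"
      using w(2) extremal(4)[of x] x r01 R z(2) by simp
    then have "M x < sin 1"
      using w(1) by (rule sin_real_value_less[rotated])
    then show False
      using M[of x] x r01 R by simp
  qed
qed

section \<open>Extremal functions\<close>

definition half_plane_map :: "complex \<Rightarrow> complex" where
  "half_plane_map z = (1 + z) / (1 - z)"

lemma one_minus_nonzero_on_disc: "z \<in> unit_disc \<Longrightarrow> 1 - z \<noteq> 0"
  by auto

lemma half_plane_map_in_class_P: "half_plane_map \<in> class_P"
proof -
  have "Re (half_plane_map z) > 0" if "z \<in> unit_disc" for z
  proof -
    have "(norm z)\<^sup>2 < 1"
      using that by (simp add: abs_square_less_1)
    moreover have "Re ((1 + z) * cnj (1 - z)) = 1 - (norm z)\<^sup>2"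
      unfolding cmod_power2 by (simp add: power2_eq_square algebra_simps)
    ultimately show ?thesis
      by (simp only: half_plane_map_def Re_complex_div_gt_0)
  qed
  moreover have "half_plane_map holomorphic_on unit_disc"
    unfolding half_plane_map_def
    using one_minus_nonzero_on_disc by (intro holomorphic_intros)
  ultimately show ?thesis
    by (simp add: class_P_def analytic_on_open half_plane_map_def)
qed

lemma Re_inverse_one_minus_gt_half:
  assumes "z \<in> unit_disc"
  shows "Re (1 / (1 - z)) > 1 / 2"
proof -
  have "1 / (1 - z) = (1 + half_plane_map z) / 2"
    using one_minus_nonzero_on_disc[OF assms] by (simp add: half_plane_map_def field_simps)
  then have Re_eq: "Re (1 / (1 - z)) = (1 + Re (half_plane_map z)) / 2"
    by (simp only:) simp
  show ?thesis
    unfolding Re_eq using class_PD(3)[OF half_plane_map_in_class_P assms] by simp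
qed

lemma inverse_one_minus_in_class_P_half: "(\<lambda>z. 1 / (1 - z)) \<in> class_P_half"
proof -
  have "(\<lambda>z::complex. 1 / (1 - z)) holomorphic_on unit_disc"
    using one_minus_nonzero_on_disc by (intro holomorphic_intros)
  then show ?thesis
    using Re_inverse_one_minus_gt_half
    by (auto simp: class_P_half_def class_P_def analytic_on_open intro: less_trans[of 0 "1/2"])
qed

lemma inverse_one_minus_in_class_P: "(\<lambda>z. 1 / (1 - z)) \<in> class_P"
  using inverse_one_minus_in_class_P_half by (simp add: class_P_half_def)

lemma log_deriv_half_plane_map:
  assumes "0 < x" "x < 1"
  shows "log_deriv half_plane_map (of_real x) = of_real (2 * x / (1 - x\<^sup>2))"
proof -
  have nz: "1 - of_real x \<noteq> (0 :: complex)" "1 + of_real x \<noteq> (0 :: complex)"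
    using assms by (auto simp: complex_eq_iff)
  then have "(half_plane_map has_field_derivative 2 / (1 - of_real x)\<^sup>2) (at (of_real x))"
    unfolding half_plane_map_def
    by (auto intro!: derivative_eq_intros simp: power2_eq_square field_simps)
  then have "log_deriv half_plane_map (of_real x)
      = of_real x * (2 / (1 - of_real x)\<^sup>2) / ((1 + of_real x) / (1 - of_real x))"
    by (simp add: log_deriv_def half_plane_map_def DERIV_imp_deriv)
  also have "\<dots> = 2 * of_real x / ((1 - of_real x) * (1 + of_real x))"
    using nz by (simp add: power2_eq_square)
  also have "\<dots> = of_real (2 * x / (1 - x\<^sup>2))"
    by (simp add: power2_eq_square algebra_simps)
  finally show ?thesis .
qed

lemma log_deriv_inverse_one_minus:
  assumes "x < 1"
  shows "log_deriv (\<lambda>z. 1 / (1 - z)) (of_real x) = of_real (x / (1 - x))"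
proof -
  have nz: "1 - of_real x \<noteq> (0 :: complex)"
    using assms by (auto simp: complex_eq_iff)
  then have "((\<lambda>z. 1 / (1 - z)) has_field_derivative 1 / (1 - of_real x)\<^sup>2) (at (of_real x :: complex))"
    by (auto intro!: derivative_eq_intros simp: power2_eq_square)
  then show ?thesis
    using nz by (simp add: log_deriv_def DERIV_imp_deriv power2_eq_square)
qed

lemma extremal_in_class_G:
  defines "k \<equiv> half_plane_map"
  shows "(\<lambda>z. z * (k z * (k z * k z))) \<in> class_G1"
    and "(\<lambda>z. z * (k z * (1 / (1 - z) * k z))) \<in> class_G2"
    and "(\<lambda>z. z * (k z * k z)) \<in> class_G3"
proof -
  have k: "k \<in> class_P" unfolding k_def by (rule half_plane_map_in_class_P)
  note khol = class_PD(1)[OF k] and k0 = class_PD(2)[OF k] and knz = class_PD(4)[OF k]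
  have dhol: "(\<lambda>z. 1 / (1 - z)) holomorphic_on unit_disc"
    by (rule class_PD(1)[OF inverse_one_minus_in_class_P])
  have A: "(\<lambda>z. z * (k z * (k z * k z))) \<in> class_A"
    "(\<lambda>z. z * (k z * (1 / (1 - z) * k z))) \<in> class_A"
    "(\<lambda>z. z * (k z * k z)) \<in> class_A" "(\<lambda>z. z * (k z * (1 / (1 - z)))) \<in> class_A"
    by (intro times_in_class_A holomorphic_on_mult khol dhol; simp add: k0)+
  show "(\<lambda>z. z * (k z * (k z * k z))) \<in> class_G1"
    unfolding class_G1_def
    \<comment> \<open>With this \<open>g\<close> and \<open>p = k\<close>, the quotients \<open>g / (z p)\<close> and \<open>f / g\<close> are both equal to \<open>k\<close>.\<close>
    by (intro CollectI conjI A bexI[of _ "\<lambda>z. z * (k z * k z)"] bexI[of _ k]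
        remove_sings_in_class_P(1)[OF _ k] k) (auto simp: knz)
  show "(\<lambda>z. z * (k z * (1 / (1 - z) * k z))) \<in> class_G2"
    unfolding class_G2_def
    \<comment> \<open>With this \<open>g\<close> and \<open>p = k\<close>, the quotient \<open>g / (z p)\<close> is \<open>1 / (1 - z)\<close>, and \<open>f / g\<close> is \<open>k\<close>.\<close>
    by (intro CollectI conjI A bexI[of _ "\<lambda>z. z * (k z * (1 / (1 - z)))"] bexI[of _ k]
        remove_sings_in_class_P(1)[OF _ k]
        remove_sings_in_class_P(2)[OF _ inverse_one_minus_in_class_P_half] k) (auto simp: knz)
  show "(\<lambda>z. z * (k z * k z)) \<in> class_G3"
    unfolding class_G3_def
    by (intro CollectI conjI A bexI[of _ k] remove_sings_in_class_P(1)[OF _ k] k) (auto simp: knz)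
qed

lemma log_deriv_extremal:
  fixes x :: real
  defines "k \<equiv> half_plane_map"
  assumes x: "0 < x" "x < 1"
  shows "log_deriv (\<lambda>z. k z * (k z * k z)) (of_real x) =
      of_real (2 * x / (1 - x\<^sup>2) + (2 * x / (1 - x\<^sup>2) + 2 * x / (1 - x\<^sup>2)))"
    and "log_deriv (\<lambda>z. k z * (1 / (1 - z) * k z)) (of_real x) =
      of_real (2 * x / (1 - x\<^sup>2) + (x / (1 - x) + 2 * x / (1 - x\<^sup>2)))"
    and "log_deriv (\<lambda>z. k z * k z) (of_real x) = of_real (2 * x / (1 - x\<^sup>2) + 2 * x / (1 - x\<^sup>2))"
proof -
  have k: "k \<in> class_P" unfolding k_def by (rule half_plane_map_in_class_P)
  note d = inverse_one_minus_in_class_P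
  have xd: "complex_of_real x \<in> unit_disc" using x by simp
  note facts = class_PD(1)[OF k] class_PD(1)[OF d] class_PD(4)[OF k xd] class_PD(4)[OF d xd]
  have lk: "log_deriv k (of_real x) = of_real (2 * x / (1 - x\<^sup>2))"
    unfolding k_def using x by (rule log_deriv_half_plane_map)
  note ld = log_deriv_inverse_one_minus[OF x(2)]
  show G3: "log_deriv (\<lambda>z. k z * k z) (of_real x) = of_real (2 * x / (1 - x\<^sup>2) + 2 * x / (1 - x\<^sup>2))"
    by (subst log_deriv_mult) (use facts xd in \<open>auto simp: lk\<close>)
  show "log_deriv (\<lambda>z. k z * (k z * k z)) (of_real x) =
      of_real (2 * x / (1 - x\<^sup>2) + (2 * x / (1 - x\<^sup>2) + 2 * x / (1 - x\<^sup>2)))"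
    by (subst log_deriv_mult) (use facts xd G3 in \<open>auto simp: lk intro!: holomorphic_on_mult\<close>)
  have dk_hol: "(\<lambda>z. 1 / (1 - z) * k z) holomorphic_on unit_disc"
    by (intro holomorphic_on_mult facts)
  have "log_deriv (\<lambda>z. 1 / (1 - z) * k z) (of_real x) =
      of_real (x / (1 - x) + 2 * x / (1 - x\<^sup>2))"
    by (subst log_deriv_mult) (use facts xd in \<open>auto simp: lk ld\<close>)
  then show "log_deriv (\<lambda>z. k z * (1 / (1 - z) * k z)) (of_real x) =
      of_real (2 * x / (1 - x\<^sup>2) + (x / (1 - x) + 2 * x / (1 - x\<^sup>2)))"
    by (subst log_deriv_mult) (use facts dk_hol xd in \<open>auto simp: lk\<close>)
qed

section \<open>The quadratic equations for the radii\<close>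

text \<open>
  The right-hand side is the positive root \<open>R\<close> of the quadratic, in rationalized form. The difference
  of the values at \<open>t\<close> and at \<open>R\<close> is \<open>(t - R) (a (t + R) + b)\<close> with a positive second factor.
\<close>

lemma quadratic_less_iff_less_root:
  fixes a b c t :: real
  assumes "0 < a" "0 < b" "0 < c" "0 \<le> t"
  shows "a * t\<^sup>2 + b * t < c \<longleftrightarrow> t < 2 * c / (b + sqrt (b\<^sup>2 + 4 * a * c))"
proof -
  define d where "d = sqrt (b\<^sup>2 + 4 * a * c)"
  define R where "R = 2 * c / (b + d)"
  have d: "0 \<le> d" "d\<^sup>2 = b\<^sup>2 + 4 * a * c"
    using assms by (auto simp: d_def)
  have pos: "0 < b + d" using d(1) assms by linarith
  then have "0 < R" using assms by (simp add: R_def)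
  have cR: "2 * c = R * (b + d)" using pos by (simp add: R_def)
  have "4 * a * c = (d - b) * (d + b)"
    using d(2) by (simp add: power2_eq_square algebra_simps)
  moreover have "2 * a * R * (b + d) = 2 * a * (2 * c)"
    unfolding cR by simp
  ultimately have "2 * a * R * (b + d) = (d - b) * (b + d)"
    by (simp add: algebra_simps)
  then have "2 * a * R = d - b" using pos by simp
  then have "d = 2 * a * R + b" by simp
  then have "2 * c = 2 * (a * R\<^sup>2 + b * R)"
    using cR by (simp add: power2_eq_square algebra_simps)
  then have root: "c = a * R\<^sup>2 + b * R" by simp
  have "a * t\<^sup>2 + b * t - c = (t - R) * (a * (t + R) + b)"
    unfolding root by (simp add: power2_eq_square algebra_simps)
  moreover have "0 < a * (t + R) + b"
    using assms \<open>0 < R\<close> by (simp add: add_nonneg_pos)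
  ultimately have "a * t\<^sup>2 + b * t - c < 0 \<longleftrightarrow> t - R < 0"
    by (metis mult_less_0_iff not_less_iff_gr_or_eq)
  then show ?thesis by (simp add: R_def d_def)
qed

lemma majorant_less_iff:
  fixes b t s :: real
  assumes "0 \<le> t" "t < 1"
  shows "b * t / (1 - t\<^sup>2) < s \<longleftrightarrow> s * t\<^sup>2 + b * t < s"
    and "b * t / (1 - t\<^sup>2) + t / (1 - t) < s \<longleftrightarrow> (1 + s) * t\<^sup>2 + (b + 1) * t < s"
proof -
  have pos: "0 < 1 - t\<^sup>2"
    using assms by (simp add: abs_square_less_1)
  have "t / (1 - t) = (t + t\<^sup>2) / (1 - t\<^sup>2)"
  proof -
    have "1 - t\<^sup>2 = (1 - t) * (1 + t)" "t + t\<^sup>2 = t * (1 + t)"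
      by (simp_all add: power2_eq_square algebra_simps)
    then show ?thesis using assms by simp
  qed
  then have sum: "b * t / (1 - t\<^sup>2) + t / (1 - t) = (b * t + (t + t\<^sup>2)) / (1 - t\<^sup>2)"
    by (simp add: add_divide_distrib)
  show "b * t / (1 - t\<^sup>2) < s \<longleftrightarrow> s * t\<^sup>2 + b * t < s"
    unfolding pos_divide_less_eq[OF pos] by (simp add: algebra_simps)
  show "b * t / (1 - t\<^sup>2) + t / (1 - t) < s \<longleftrightarrow> (1 + s) * t\<^sup>2 + (b + 1) * t < s"
    unfolding sum pos_divide_less_eq[OF pos] by (simp add: algebra_simps)
qed

text \<open>
  The radius for the first class, \<open>0.137590...\<close>, is within \<open>0.00001\<close> of the edge \<open>0.1376\<close> of its
  tolerance, so \<open>sin 1\<close> has to be known to better than \<open>0.0001\<close>.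
\<close>

lemma sin_one_bounds: "84146 / 100000 < sin (1::real)" "sin (1::real) < 84148 / 100000"
proof -
  have "\<bar>sin 1 - (\<Sum>m<9. sin_coeff m * 1 ^ m)\<bar> \<le> inverse (fact 9) * \<bar>1::real\<bar> ^ 9"
    by (rule Maclaurin_sin_bound)
  moreover have "{..<9} = {0, 1, 2, 3, 4, 5, 6, 7, 8 :: nat}"
    by auto
  ultimately have "\<bar>sin 1 - (1 - 1/6 + 1/120 - 1/5040)\<bar> \<le> (1/362880 :: real)"
    by (simp add: sin_coeff_def fact_numeral)
  then show "84146 / 100000 < sin (1::real)" "sin (1::real) < 84148 / 100000"
    unfolding abs_le_iff by linarith+
qed

text \<open>
  The quadratics for the first and the third class are halved before their root is taken: then the
  common factor \<open>2\<close> under and outside the square root in the general root formula disappears.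
\<close>

lemma less_radius_iff:
  fixes t :: real
  assumes "0 \<le> t"
  defines "s \<equiv> sin (1 :: real)"
  shows "t < s / (3 + sqrt (9 + s\<^sup>2)) \<longleftrightarrow> s * t\<^sup>2 + 6 * t < s"
    and "t < 2 * s / (5 + sqrt (25 + 4 * s + 4 * s\<^sup>2)) \<longleftrightarrow> (1 + s) * t\<^sup>2 + 5 * t < s"
    and "t < s / (2 + sqrt (4 + s\<^sup>2)) \<longleftrightarrow> s * t\<^sup>2 + 4 * t < s"
proof -
  have s: "0 < s" using sin_one_bounds(1) by (simp add: s_def)
  have half: "s / 2 * t\<^sup>2 + b / 2 * t < s / 2 \<longleftrightarrow> s * t\<^sup>2 + b * t < s" for b
    by linarith
  show "t < s / (3 + sqrt (9 + s\<^sup>2)) \<longleftrightarrow> s * t\<^sup>2 + 6 * t < s"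
    using quadratic_less_iff_less_root[of "s / 2" 3 "s / 2" t] s assms half[of 6]
    by (simp add: power2_eq_square)
  show "t < s / (2 + sqrt (4 + s\<^sup>2)) \<longleftrightarrow> s * t\<^sup>2 + 4 * t < s"
    using quadratic_less_iff_less_root[of "s / 2" 2 "s / 2" t] s assms half[of 4]
    by (simp add: power2_eq_square)
  have discr: "5\<^sup>2 + 4 * (1 + s) * s = 25 + 4 * s + 4 * s\<^sup>2"
    by (simp add: power2_eq_square algebra_simps)
  show "t < 2 * s / (5 + sqrt (25 + 4 * s + 4 * s\<^sup>2)) \<longleftrightarrow> (1 + s) * t\<^sup>2 + 5 * t < s"
    using quadratic_less_iff_less_root[of "1 + s" 5 s t] s assms unfolding discr by linarith
qed

text \<open>
  By \<open>less_radius_iff\<close> a comparison with a radius amounts to an inequality that is linear in \<open>sin 1\<close>.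
  That lemma only tells which numbers are below the radius, so a strict upper bound comes from a
  slightly smaller number that is not below the radius.
\<close>

lemma radius_bounds:
  defines "s \<equiv> sin (1 :: real)"
  shows "1375 / 10000 < s / (3 + sqrt (9 + s\<^sup>2))" "s / (3 + sqrt (9 + s\<^sup>2)) < 1376 / 10000"
    and "1589 / 10000 < 2 * s / (5 + sqrt (25 + 4 * s + 4 * s\<^sup>2))"
      "2 * s / (5 + sqrt (25 + 4 * s + 4 * s\<^sup>2)) < 1590 / 10000"
    and "2017 / 10000 < s / (2 + sqrt (4 + s\<^sup>2))" "s / (2 + sqrt (4 + s\<^sup>2)) < 2019 / 10000"
proof -
  note b = sin_one_bounds[folded s_def]
  note iff = less_radius_iff[folded s_def]
  show "1375 / 10000 < s / (3 + sqrt (9 + s\<^sup>2))"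
    by (subst iff(1)) (use b in \<open>simp_all add: power2_eq_square\<close>)
  show "1589 / 10000 < 2 * s / (5 + sqrt (25 + 4 * s + 4 * s\<^sup>2))"
    by (subst iff(2)) (use b in \<open>simp_all add: power2_eq_square field_simps\<close>)
  show "2017 / 10000 < s / (2 + sqrt (4 + s\<^sup>2))"
    by (subst iff(3)) (use b in \<open>simp_all add: power2_eq_square\<close>)
  have "\<not> 137595 / 1000000 < s / (3 + sqrt (9 + s\<^sup>2))"
    by (subst iff(1)) (use b in \<open>simp_all add: power2_eq_square\<close>)
  then show "s / (3 + sqrt (9 + s\<^sup>2)) < 1376 / 10000" by linarith
  have "\<not> 15899 / 100000 < 2 * s / (5 + sqrt (25 + 4 * s + 4 * s\<^sup>2))"
    by (subst iff(2)) (use b in \<open>simp_all add: power2_eq_square field_simps\<close>)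
  then show "2 * s / (5 + sqrt (25 + 4 * s + 4 * s\<^sup>2)) < 1590 / 10000" by linarith
  have "\<not> 20185 / 100000 < s / (2 + sqrt (4 + s\<^sup>2))"
    by (subst iff(3)) (use b in \<open>simp_all add: power2_eq_square\<close>)
  then show "s / (2 + sqrt (4 + s\<^sup>2)) < 2019 / 10000" by linarith
qed

section \<open>The three radii\<close>

lemma radius_G1: "is_class_radius class_S_sin class_G1 (sin 1 / (3 + sqrt (9 + (sin 1)\<^sup>2)))"
proof (rule sine_starlike_radiusI[where
      M = "\<lambda>t. 2 * t / (1 - t\<^sup>2) + (2 * t / (1 - t\<^sup>2) + 2 * t / (1 - t\<^sup>2))" and
      \<psi> = "\<lambda>z. half_plane_map z * (half_plane_map z * half_plane_map z)"])
  show "0 < sin 1 / (3 + sqrt (9 + (sin (1::real))\<^sup>2))" "sin 1 / (3 + sqrt (9 + (sin (1::real))\<^sup>2)) < 1"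
    using radius_bounds(1,2) by linarith+
  fix t :: real assume "0 \<le> t" "t < 1"
  then show "2 * t / (1 - t\<^sup>2) + (2 * t / (1 - t\<^sup>2) + 2 * t / (1 - t\<^sup>2)) < sin 1 \<longleftrightarrow>
      t < sin 1 / (3 + sqrt (9 + (sin 1)\<^sup>2))"
    using majorant_less_iff(1)[of t 6 "sin 1"] less_radius_iff(1)[of t]
    by (simp flip: add_divide_distrib)
next
  show "\<exists>\<phi>. log_deriv_majorized \<phi>
      (\<lambda>t. 2 * t / (1 - t\<^sup>2) + (2 * t / (1 - t\<^sup>2) + 2 * t / (1 - t\<^sup>2))) \<and>
      (\<forall>z\<in>unit_disc. f z = z * \<phi> z)" if "f \<in> class_G1" for f
    using that by (rule class_G1_majorized)
  show "(\<lambda>z. z * (half_plane_map z * (half_plane_map z * half_plane_map z))) \<in> class_G1"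
    by (rule extremal_in_class_G(1))
  show "(\<lambda>z. half_plane_map z * (half_plane_map z * half_plane_map z)) holomorphic_on unit_disc"
    by (intro holomorphic_on_mult class_PD(1) half_plane_map_in_class_P)
  show "half_plane_map z * (half_plane_map z * half_plane_map z) \<noteq> 0" if "z \<in> unit_disc" for z
    using class_PD(4)[OF half_plane_map_in_class_P that] by simp
  show "log_deriv (\<lambda>z. half_plane_map z * (half_plane_map z * half_plane_map z)) (of_real x) =
      of_real (2 * x / (1 - x\<^sup>2) + (2 * x / (1 - x\<^sup>2) + 2 * x / (1 - x\<^sup>2)))"
    if "0 < x" "x < 1" for x
    using that by (rule log_deriv_extremal(1))
qed

lemma radius_G2:
  "is_class_radius class_S_sin class_G2 (2 * sin 1 / (5 + sqrt (25 + 4 * sin 1 + 4 * (sin 1)\<^sup>2)))"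
proof (rule sine_starlike_radiusI[where
      M = "\<lambda>t. 2 * t / (1 - t\<^sup>2) + (t / (1 - t) + 2 * t / (1 - t\<^sup>2))" and
      \<psi> = "\<lambda>z. half_plane_map z * (1 / (1 - z) * half_plane_map z)"])
  show "0 < 2 * sin 1 / (5 + sqrt (25 + 4 * sin 1 + 4 * (sin (1::real))\<^sup>2))"
    "2 * sin 1 / (5 + sqrt (25 + 4 * sin 1 + 4 * (sin (1::real))\<^sup>2)) < 1"
    using radius_bounds(3,4) by linarith+
  fix t :: real assume "0 \<le> t" "t < 1"
  moreover have "2 * t / (1 - t\<^sup>2) + (t / (1 - t) + 2 * t / (1 - t\<^sup>2)) =
      4 * t / (1 - t\<^sup>2) + t / (1 - t)"
    by (simp flip: add_divide_distrib add: add.left_commute add.commute)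
  ultimately show "2 * t / (1 - t\<^sup>2) + (t / (1 - t) + 2 * t / (1 - t\<^sup>2)) < sin 1 \<longleftrightarrow>
      t < 2 * sin 1 / (5 + sqrt (25 + 4 * sin 1 + 4 * (sin 1)\<^sup>2))"
    using majorant_less_iff(2)[of t 4 "sin 1"] less_radius_iff(2)[of t] by simp
next
  show "\<exists>\<phi>. log_deriv_majorized \<phi>
      (\<lambda>t. 2 * t / (1 - t\<^sup>2) + (t / (1 - t) + 2 * t / (1 - t\<^sup>2))) \<and>
      (\<forall>z\<in>unit_disc. f z = z * \<phi> z)" if "f \<in> class_G2" for f
    using that by (rule class_G2_majorized)
  show "(\<lambda>z. z * (half_plane_map z * (1 / (1 - z) * half_plane_map z))) \<in> class_G2"
    by (rule extremal_in_class_G(2))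
  show "(\<lambda>z. half_plane_map z * (1 / (1 - z) * half_plane_map z)) holomorphic_on unit_disc"
    by (intro holomorphic_on_mult class_PD(1) half_plane_map_in_class_P inverse_one_minus_in_class_P)
  show "half_plane_map z * (1 / (1 - z) * half_plane_map z) \<noteq> 0" if "z \<in> unit_disc" for z
    using class_PD(4)[OF half_plane_map_in_class_P that] one_minus_nonzero_on_disc[OF that] by simp
  show "log_deriv (\<lambda>z. half_plane_map z * (1 / (1 - z) * half_plane_map z)) (of_real x) =
      of_real (2 * x / (1 - x\<^sup>2) + (x / (1 - x) + 2 * x / (1 - x\<^sup>2)))"
    if "0 < x" "x < 1" for x
    using that by (rule log_deriv_extremal(2))
qed

lemma radius_G3: "is_class_radius class_S_sin class_G3 (sin 1 / (2 + sqrt (4 + (sin 1)\<^sup>2)))"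
proof (rule sine_starlike_radiusI[where
      M = "\<lambda>t. 2 * t / (1 - t\<^sup>2) + 2 * t / (1 - t\<^sup>2)" and
      \<psi> = "\<lambda>z. half_plane_map z * half_plane_map z"])
  show "0 < sin 1 / (2 + sqrt (4 + (sin (1::real))\<^sup>2))" "sin 1 / (2 + sqrt (4 + (sin (1::real))\<^sup>2)) < 1"
    using radius_bounds(5,6) by linarith+
  fix t :: real assume "0 \<le> t" "t < 1"
  then show "2 * t / (1 - t\<^sup>2) + 2 * t / (1 - t\<^sup>2) < sin 1 \<longleftrightarrow>
      t < sin 1 / (2 + sqrt (4 + (sin 1)\<^sup>2))"
    using majorant_less_iff(1)[of t 4 "sin 1"] less_radius_iff(3)[of t]
    by (simp flip: add_divide_distrib)
next
  show "\<exists>\<phi>. log_deriv_majorized \<phi>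
      (\<lambda>t. 2 * t / (1 - t\<^sup>2) + 2 * t / (1 - t\<^sup>2)) \<and>
      (\<forall>z\<in>unit_disc. f z = z * \<phi> z)" if "f \<in> class_G3" for f
    using that by (rule class_G3_majorized)
  show "(\<lambda>z. z * (half_plane_map z * half_plane_map z)) \<in> class_G3"
    by (rule extremal_in_class_G(3))
  show "(\<lambda>z. half_plane_map z * half_plane_map z) holomorphic_on unit_disc"
    by (intro holomorphic_on_mult class_PD(1) half_plane_map_in_class_P)
  show "half_plane_map z * half_plane_map z \<noteq> 0" if "z \<in> unit_disc" for z
    using class_PD(4)[OF half_plane_map_in_class_P that] by simp
  show "log_deriv (\<lambda>z. half_plane_map z * half_plane_map z) (of_real x) =
      of_real (2 * x / (1 - x\<^sup>2) + 2 * x / (1 - x\<^sup>2))"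
    if "0 < x" "x < 1" for x
    using that by (rule log_deriv_extremal(3))
qed

theorem theorem3p6:
  shows "(is_class_radius class_S_sin class_G1 (sin 1 / (3 + sqrt (9 + (sin 1)\<^sup>2))) \<and>
          \<bar>sin 1 / (3 + sqrt (9 + (sin 1)\<^sup>2)) - (0.1375::real)\<bar> < 0.0001) \<and>
         (is_class_radius class_S_sin class_G2
            (2 * sin 1 / (5 + sqrt (25 + 4 * sin 1 + 4 * (sin 1)\<^sup>2))) \<and>
          \<bar>2 * sin 1 / (5 + sqrt (25 + 4 * sin 1 + 4 * (sin 1)\<^sup>2)) - (0.1589::real)\<bar> < 0.0001) \<and>
         (is_class_radius class_S_sin class_G3 (sin 1 / (2 + sqrt (4 + (sin 1)\<^sup>2))) \<and>
          \<bar>sin 1 / (2 + sqrt (4 + (sin 1)\<^sup>2)) - (0.2018::real)\<bar> < 0.0001)"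
proof -
  \<comment> \<open>Decimal literals stand for quotients by a power of ten, the form of the conclusion here.\<close>
  have near: "\<bar>x - a / 10 ^ 4\<bar> < 1 / 10 ^ 4"
    if "(a - 1) / 10000 < x" "x < (a + 1) / 10000" for x a :: real
    using that unfolding abs_diff_less_iff by (simp add: diff_divide_distrib add_divide_distrib)
  show ?thesis
    by (intro conjI radius_G1 radius_G2 radius_G3; rule near) (use radius_bounds in simp_all)
qed

end
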